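(* Let $\mathcal{T}\in\mathbb{R}^{n_1\times n_2\times n_3}$ satisfy $\mathcal{T}=(U_1^{\#},U_2^{\#},U_3^{\#}).\mathcal{G}^{\#}$ where $U_i^{\#}\in\mathbb{R}^{n_i\times r_i}_+$ with $(U_i^{\#})^\top e=e$ for $i\in\{1,2,3\}$, $\mathcal{G}^{\#}\in\mathbb{R}^{r_1\times r_2\times r_3}$, $\operatorname{rank}(\mathcal{G}^{\#}_{(3)})=r_3=r_1r_2$, and both $U_1^{\#}\otimes U_2^{\#}$ and $U_3^{\#}$ satisfy the SSC. Let $(U_1^*,U_2^*,U_3^*,\mathcal{G}^* )$ be any output of the following procedure: 1. Let $(G^*,U_{1,2}^*,U_3^* )$ be an optimal solution of $$\min_{G\in\mathbb{R}^{r_1r_2\times r_3},\,U_{1,2}\in\mathbb{R}^{n_1n_2\times r_1r_2},\,U_3\in\mathbb{R}^{n_3\times r_3}} |\det(G)|\ \text{ such that }\ \mathcal{T}_{(3)}=U_{1,2}\,G\,U_3^\top,\ U_{1,2}^\top e=e,\ U_3^\top e=e,\ U_{1,2}\ge0,\ U_3\ge0.$$ 2. Let $\Pi_{1,2}^*$ be an $r_1r_2\times r_1r_2$ permutation matrix such that $U_{1,2}^*\Pi_{1,2}^*=U_1^*\otimes U_2^*$ for some $U_1^*\in\mathbb{R}^{n_1\times r_1}$, $U_2^*\in\mathbb{R}^{n_2\times r_2}$ with $(U_1^* )^\top e=e$ and $(U_2^* )^\top e=e$. 3. Let $\mathcal{G}^*\in\mathbb{R}^{r_1\times r_2\times r_3}$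 be the tensor whose third-mode unfolding is $\mathcal{G}^*_{(3)}=(\Pi_{1,2}^* )^\top G^*$. Then there exist permutation matrices $\Pi_1,\Pi_2,\Pi_3$ such that $U_i^*=U_i^{\#}\Pi_i$ for all $i\in\{1,2,3\}$ and $\mathcal{G}^*=(\Pi_1^\top,\Pi_2^\top,\Pi_3^\top).\mathcal{G}^{\#}$.
   Context: $e$ is the all-ones vector of appropriate dimension, $e_k$ the $k$-th standard basis vector, and $\ge$ is entrywise. For matrices $U_i\in\mathbb{R}^{n_i\times r_i}$ and $\mathcal{G}\in\mathbb{R}^{r_1\times r_2\times r_3}$, the tensor $(U_1,U_2,U_3).\mathcal{G}\in\mathbb{R}^{n_1\times n_2\times n_3}$ has entries $\sum_{i_1,i_2,i_3}(U_1)_{j_1,i_1}(U_2)_{j_2,i_2}(U_3)_{j_3,i_3}\mathcal{G}_{i_1,i_2,i_3}$. The third-mode unfolding of $\mathcal{T}\in\mathbb{R}^{n_1\times n_2\times n_3}$ is $\mathcal{T}_{(3)}\in\mathbb{R}^{n_1n_2\times n_3}$ with $(\mathcal{T}_{(3)})_{(i,j),k}=\mathcal{T}_{i,j,k}$, where the pair $(i,j)$ stands for the index $i+(j-1)n_1$. For $A\in\mathbb{R}^{m\times M}$, $B\in\mathbb{R}^{n\times N}$, $A\otimes B\in\mathbb{R}^{mn\times MN}$ has entries $(A\otimes B)_{(k,l),(i,j)}=A_{k,i}B_{l,j}$, where $(k,l)$ stands for $k+(l-1)m$ and $(i,j)$ for $i+(j-1)M$. For $A\in\mathbb{R}^{m\times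 n}$, $\operatorname{cone}(A)=\{Ay : y\in\mathbb{R}^n, y\ge 0\}$ and $\operatorname{cone}^*(A)=\{y\in\mathbb{R}^m : A^\top y\ge 0\}$. A matrix $H\in\mathbb{R}^{n\times r}_+$ with $r\ge2$ satisfies the sufficiently scattered condition (SSC) if: (SSC1) $\{x\in\mathbb{R}^r_+ : e^\top x\ge\sqrt{r-1}\,\|x\|_2\}\subseteq\operatorname{cone}(H^\top)$; and (SSC2) $\operatorname{cone}^*(H^\top)\cap\operatorname{bd}(\mathcal{C}^* )=\{\lambda e_k : \lambda\ge0,\ k\in\{1,\dots,r\}\}$, where $\mathcal{C}^*=\{x\in\mathbb{R}^r : e^\top x\ge\|x\|_2\}$ and $\operatorname{bd}$ denotes the boundary. *)

theory Defs
  imports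
    "HOL-Analysis.Abstract_Metric_Spaces"
    "HOL-Analysis.L2_Norm"
    "Jordan_Normal_Form.DL_Rank"
begin

text \<open>All indices start at 0, so the pair \<open>(i, j)\<close> with \<open>i < m\<close> stands for the index
  \<open>i + j * m\<close>, and the index \<open>p\<close> stands for the pair \<open>(p mod m, p div m)\<close>.\<close>

definition ones_vec :: "nat \<Rightarrow> real vec" where
  "ones_vec n = vec n (\<lambda>_. 1)"

definition nonneg_mat :: "real mat \<Rightarrow> bool" where
  "nonneg_mat A \<longleftrightarrow> 0\<^sub>m (dim_row A) (dim_col A) \<le> A"

definition permutation_mat :: "nat \<Rightarrow> real mat \<Rightarrow> bool" where
  "permutation_mat n P \<longleftrightarrow>
     (\<exists>\<pi>. \<pi> permutes {..<n} \<and> P = mat n n (\<lambda>(i, j). if i = \<pi> j then 1 else 0))"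

definition kron :: "real mat \<Rightarrow> real mat \<Rightarrow> real mat" (infixl \<open>\<otimes>\<^sub>k\<close> 70) where
  "A \<otimes>\<^sub>k B = mat (dim_row A * dim_row B) (dim_col A * dim_col B)
     (\<lambda>(p, q). A $$ (p mod dim_row A, q mod dim_col A) * B $$ (p div dim_row A, q div dim_col A))"

text \<open>An \<open>n1 \<times> n2 \<times> n3\<close> tensor is a function that vanishes outside the index range, so that
  equality of tensors is equality of functions.\<close>

type_synonym tensor3 = "nat \<Rightarrow> nat \<Rightarrow> nat \<Rightarrow> real"

definition carrier_tensor :: "nat \<Rightarrow> nat \<Rightarrow> nat \<Rightarrow> tensor3 set" where
  "carrier_tensor n1 n2 n3 = {T. \<forall>i j k. \<not> (i < n1 \<and> j < n2 \<and> k < n3) \<longrightarrow> T i j k = 0}"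

definition multilinear_mult :: "real mat \<Rightarrow> real mat \<Rightarrow> real mat \<Rightarrow> tensor3 \<Rightarrow> tensor3" where
  "multilinear_mult U1 U2 U3 G = (\<lambda>j1 j2 j3.
     if j1 < dim_row U1 \<and> j2 < dim_row U2 \<and> j3 < dim_row U3
     then \<Sum>i1<dim_col U1. \<Sum>i2<dim_col U2. \<Sum>i3<dim_col U3.
            U1 $$ (j1, i1) * U2 $$ (j2, i2) * U3 $$ (j3, i3) * G i1 i2 i3
     else 0)"

definition unfold3 :: "nat \<Rightarrow> nat \<Rightarrow> nat \<Rightarrow> tensor3 \<Rightarrow> real mat" where
  "unfold3 n1 n2 n3 T = mat (n1 * n2) n3 (\<lambda>(p, k). T (p mod n1) (p div n1) k)"

lemma pair_index_less:
  fixes i j m n :: nat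
  assumes "i < m" "j < n"
  shows "i + j * m < m * n"
proof -
  have "i + j * m < Suc j * m" using assms(1) by simp
  also have "\<dots> \<le> n * m" using assms(2) by (intro mult_le_mono1) simp
  finally show ?thesis by (simp add: mult.commute)
qed

lemma index_kron:
  assumes "k < dim_row A" "l < dim_row B" "i < dim_col A" "j < dim_col B"
  shows "(A \<otimes>\<^sub>k B) $$ (k + l * dim_row A, i + j * dim_col A) = A $$ (k, i) * B $$ (l, j)"
  using assms by (simp add: kron_def pair_index_less)

lemma index_unfold3:
  assumes "i < n1" "j < n2" "k < n3"
  shows "unfold3 n1 n2 n3 T $$ (i + j * n1, k) = T i j k"
  using assms by (simp add: unfold3_def pair_index_less)

definition cone :: "real mat \<Rightarrow> real vec set" where
  "cone A = {A *\<^sub>v y | y. y \<in> carrier_vec (dim_col A) \<and> 0\<^sub>v (dim_col A) \<le> y}"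

definition dual_cone :: "real mat \<Rightarrow> real vec set" where
  "dual_cone A = {y \<in> carrier_vec (dim_row A). 0\<^sub>v (dim_col A) \<le> A\<^sup>T *\<^sub>v y}"

definition norm_vec :: "real vec \<Rightarrow> real" where
  "norm_vec x = L2_set (\<lambda>i. x $ i) {..<dim_vec x}"

text \<open>The distance takes the dimension as a parameter because \<open>Metric_space\<close> demands
  symmetry on the whole type, where vectors of different dimensions occur.\<close>

definition dist_vec :: "nat \<Rightarrow> real vec \<Rightarrow> real vec \<Rightarrow> real" where
  "dist_vec r x y = L2_set (\<lambda>i. x $ i - y $ i) {..<r}"

lemma dist_vec_eq_norm:
  assumes "x \<in> carrier_vec r" "y \<in> carrier_vec r"
  shows "dist_vec r x y = norm_vec (x - y)"
  using assms by (auto simp: dist_vec_def norm_vec_def intro!: L2_set_cong)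

lemma Metric_space_vec: "Metric_space (carrier_vec r) (dist_vec r)"
proof
  show "0 \<le> dist_vec r x y" for x y
    by (simp add: dist_vec_def)
  show "dist_vec r x y = dist_vec r y x" for x y
    by (simp add: dist_vec_def L2_set_def power2_commute)
  show "dist_vec r x y = 0 \<longleftrightarrow> x = y" if "x \<in> carrier_vec r" "y \<in> carrier_vec r" for x y
    using that by (auto simp: dist_vec_def L2_set_eq_0_iff)
  show "dist_vec r x z \<le> dist_vec r x y + dist_vec r y z" for x y z
    using L2_set_triangle_ineq[of "\<lambda>i. x $ i - y $ i" "\<lambda>i. y $ i - z $ i" "{..<r}"]
    by (simp add: dist_vec_def)
qed

definition boundary :: "nat \<Rightarrow> real vec set \<Rightarrow> real vec set" where
  "boundary r S = Metric_space.mtopology (carrier_vec r) (dist_vec r) frontier_of S"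

definition C_star :: "nat \<Rightarrow> real vec set" where
  "C_star r = {x \<in> carrier_vec r. scalar_prod (ones_vec r) x \<ge> norm_vec x}"

definition SSC1 :: "real mat \<Rightarrow> bool" where
  "SSC1 H \<longleftrightarrow> (let r = dim_col H in
     {x \<in> carrier_vec r. 0\<^sub>v r \<le> x \<and> scalar_prod (ones_vec r) x \<ge> sqrt (real r - 1) * norm_vec x}
       \<subseteq> cone (H\<^sup>T))"

definition SSC2 :: "real mat \<Rightarrow> bool" where
  "SSC2 H \<longleftrightarrow> (let r = dim_col H in
     dual_cone (H\<^sup>T) \<inter> boundary r (C_star r) = {c \<cdot>\<^sub>v unit_vec r k | c k. 0 \<le> c \<and> k < r})"

definition SSC :: "real mat \<Rightarrow> bool" where
  "SSC H \<longleftrightarrow> dim_col H \<ge> 2 \<and> nonneg_mat H \<and> SSC1 H \<and> SSC2 H"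

definition min_vol_feasible ::
    "nat \<Rightarrow> nat \<Rightarrow> nat \<Rightarrow> nat \<Rightarrow> nat \<Rightarrow> nat \<Rightarrow> tensor3 \<Rightarrow> real mat \<times> real mat \<times> real mat \<Rightarrow> bool" where
  "min_vol_feasible n1 n2 n3 r1 r2 r3 T = (\<lambda>(G, U12, U3).
     G \<in> carrier_mat (r1 * r2) r3 \<and>
     U12 \<in> carrier_mat (n1 * n2) (r1 * r2) \<and>
     U3 \<in> carrier_mat n3 r3 \<and>
     unfold3 n1 n2 n3 T = U12 * G * U3\<^sup>T \<and>
     U12\<^sup>T *\<^sub>v ones_vec (n1 * n2) = ones_vec (r1 * r2) \<and>
     U3\<^sup>T *\<^sub>v ones_vec n3 = ones_vec r3 \<and>
     nonneg_mat U12 \<and> nonneg_mat U3)"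

text \<open>Meaningful only for \<open>r3 = r1 * r2\<close>: the library's \<^const>\<open>det\<close> is 0 on non-square matrices.\<close>

definition min_vol_optimal ::
    "nat \<Rightarrow> nat \<Rightarrow> nat \<Rightarrow> nat \<Rightarrow> nat \<Rightarrow> nat \<Rightarrow> tensor3 \<Rightarrow> real mat \<Rightarrow> real mat \<Rightarrow> real mat \<Rightarrow> bool" where
  "min_vol_optimal n1 n2 n3 r1 r2 r3 T G U12 U3 \<longleftrightarrow>
     is_arg_min (\<lambda>(G, U12, U3). \<bar>det G\<bar>) (min_vol_feasible n1 n2 n3 r1 r2 r3 T) (G, U12, U3)"

definition procedure_output ::
    "nat \<Rightarrow> nat \<Rightarrow> nat \<Rightarrow> nat \<Rightarrow> nat \<Rightarrow> nat \<Rightarrow> tensor3 \<Rightarrow>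
     real mat \<Rightarrow> real mat \<Rightarrow> real mat \<Rightarrow> tensor3 \<Rightarrow> bool" where
  "procedure_output n1 n2 n3 r1 r2 r3 T U1 U2 U3 \<G> \<longleftrightarrow>
     (\<exists>G U12 P.
        min_vol_optimal n1 n2 n3 r1 r2 r3 T G U12 U3 \<and>
        permutation_mat (r1 * r2) P \<and>
        U1 \<in> carrier_mat n1 r1 \<and> U2 \<in> carrier_mat n2 r2 \<and>
        U1\<^sup>T *\<^sub>v ones_vec n1 = ones_vec r1 \<and>
        U2\<^sup>T *\<^sub>v ones_vec n2 = ones_vec r2 \<and>
        U12 * P = U1 \<otimes>\<^sub>k U2 \<and>
        \<G> \<in> carrier_tensor r1 r2 r3 \<and>
        unfold3 r1 r2 r3 \<G> = P\<^sup>T * G)"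

end

theory Submission
  imports Defs "HOL-Analysis.Convex"
begin

text \<open>With \<open>W = U1 \<otimes>\<^sub>k U2\<close> the unfolding of the tensor is \<open>W G U3\<^sup>T\<close>, all three factors of rank \<open>r\<close>, so
  an optimal solution has the form \<open>X = W A\<close>, \<open>Y = U3 B\<close> with \<open>G = A H B\<^sup>T\<close>, and optimality gives
  \<open>\<bar>det A\<bar> \<bar>det B\<bar> \<ge> 1\<close>. Dualizing SSC1, the columns of \<open>A\<close> lie in \<open>C\<^sup>*\<close>; their entries sum to 1,
  so their norms are at most 1, and Hadamard's inequality yields \<open>\<bar>det A\<bar> \<le> 1\<close>. Likewise for \<open>B\<close>.
  Hence equality holds, the columns lie on the boundary of \<open>C\<^sup>*\<close>, and by SSC2 they are unit vectors.
  Finally a permutation of the columns of \<open>U1 \<otimes>\<^sub>k U2\<close> that produces a Kronecker product of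
  column-stochastic matrices splits into permutations of the columns of \<open>U1\<close> and \<open>U2\<close>.\<close>

subsection \<open>Hadamard's inequality\<close>

text \<open>Replacing column \<open>k\<close> by its projection onto the vector of its cofactors keeps the determinant,
  because that vector is orthogonal to the other columns.\<close>

lemma orthogonalize_column:
  fixes A :: "real mat"
  assumes A: "A \<in> carrier_mat n n" and k: "k < n" and det: "det A \<noteq> 0"
  obtains B where "B \<in> carrier_mat n n" "det B = det A"
    "\<And>i j. i < n \<Longrightarrow> j < n \<Longrightarrow> j \<noteq> k \<Longrightarrow> B $$ (i, j) = A $$ (i, j)"
    "\<And>j. j < n \<Longrightarrow> j \<noteq> k \<Longrightarrow> (\<Sum>i<n. B $$ (i, j) * B $$ (i, k)) = 0"
    "(\<Sum>i<n. (B $$ (i, k))\<^sup>2) \<le> (\<Sum>i<n. (A $$ (i, k))\<^sup>2)"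
proof -
  define c where "c i = cofactor A i k" for i
  define s where "s = (\<Sum>i<n. (c i)\<^sup>2)"
  \<comment> \<open>\<open>c\<close> is row \<open>k\<close> of the adjugate, so it is orthogonal to
    every column except the \<open>k\<close>-th, whose inner product with \<open>c\<close> is
    \<open>det A\<close>.\<close>
  have Ac: "(\<Sum>i<n. A $$ (i, j) * c i) = (if j = k then det A else 0)" if j: "j < n" for j
  proof -
    have "(\<Sum>i<n. A $$ (i, j) * c i) = (adj_mat A * A) $$ (k, j)"
      using A j k by (auto simp: adj_mat_def scalar_prod_def c_def lessThan_atLeast0 mult.commute
          intro!: sum.cong)
    then show ?thesis
      using adj_mat(3)[OF A] j k by simp
  qed
  have cs: "(det A)\<^sup>2 \<le> (\<Sum>i<n. (A $$ (i, k))\<^sup>2) * s"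
    using Cauchy_Schwarz_ineq_sum[of "\<lambda>i. A $$ (i, k)" c "{..<n}"] Ac[OF k] by (simp add: s_def)
  have "s \<noteq> 0"
    using cs det by auto
  then have s: "s > 0"
    unfolding s_def by (metis sum_nonneg zero_le_power2 order_le_less)
  define B where "B = mat n n (\<lambda>(i, j). if j = k then det A / s * c i else A $$ (i, j))"
  have B: "B \<in> carrier_mat n n"
    by (simp add: B_def)
  \<comment> \<open>Cofactors along column \<open>k\<close> never see column \<open>k\<close>, so
    the Laplace expansion of \<open>B\<close> reuses \<open>c\<close>.\<close>
  have cof: "cofactor B i k = c i" if "i < n" for i
  proof -
    have "mat_delete B i k = mat_delete A i k"
      using A that k by (intro eq_matI) (auto simp: mat_delete_def B_def)
    then show ?thesis
      by (simp add: c_def cofactor_def)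
  qed
  show ?thesis
  proof
    show "B \<in> carrier_mat n n"
      by (fact B)
    have "det B = (\<Sum>i<n. det A / s * (c i)\<^sup>2)"
      unfolding laplace_expansion_column[OF B k]
      using k by (intro sum.cong) (auto simp: cof, simp add: B_def power2_eq_square)
    also have "\<dots> = det A / s * s"
      by (simp add: s_def sum_distrib_left)
    finally show "det B = det A"
      using s by simp
    show "B $$ (i, j) = A $$ (i, j)" if "i < n" "j < n" "j \<noteq> k" for i j
      using that by (simp add: B_def)
    show "(\<Sum>i<n. B $$ (i, j) * B $$ (i, k)) = 0" if "j < n" "j \<noteq> k" for j
    proof -
      have "(\<Sum>i<n. B $$ (i, j) * B $$ (i, k)) = (\<Sum>i<n. det A / s * (A $$ (i, j) * c i))"
        using that k by (intro sum.cong) (auto simp: B_def)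
      also have "\<dots> = det A / s * (\<Sum>i<n. A $$ (i, j) * c i)"
        by (simp only: sum_distrib_left)
      also have "\<dots> = 0"
        using Ac[OF that(1)] that(2) by simp
      finally show ?thesis .
    qed
    have "(\<Sum>i<n. (B $$ (i, k))\<^sup>2) = (\<Sum>i<n. (det A / s)\<^sup>2 * (c i)\<^sup>2)"
      using k by (intro sum.cong) (auto simp: B_def power_mult_distrib power_divide)
    also have "\<dots> = (det A / s)\<^sup>2 * s"
      by (simp add: s_def sum_distrib_left)
    also have "\<dots> = (det A)\<^sup>2 / s"
      using s by (simp add: power2_eq_square)
    also have "\<dots> \<le> (\<Sum>i<n. (A $$ (i, k))\<^sup>2)"
      using cs s by (simp add: divide_simps)
    finally show "(\<Sum>i<n. (B $$ (i, k))\<^sup>2) \<le> (\<Sum>i<n. (A $$ (i, k))\<^sup>2)" .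
  qed
qed

text \<open>Treating the columns one after another with \<open>orthogonalize_column\<close> keeps
  the determinant, lengthens no column and ends with orthogonal columns. The Gram matrix is then
  diagonal, and its determinant \<open>(det B)\<^sup>2\<close> is the product of the squared column
  lengths.\<close>

theorem Hadamard_inequality:
  fixes A :: "real mat"
  assumes A: "A \<in> carrier_mat n n"
  shows "(det A)\<^sup>2 \<le> (\<Prod>k<n. \<Sum>i<n. (A $$ (i, k))\<^sup>2)"
proof (cases "det A = 0")
  case True
  then show ?thesis
    by (simp add: prod_nonneg sum_nonneg)
next
  case False
  \<comment> \<open>Induction invariant: the first \<open>m\<close> columns are orthogonal to all
    other columns, including those not yet treated.\<close>
  have "\<exists>B. B \<in> carrier_mat n n \<and> det B = det A \<and>
      (\<forall>k<m. \<forall>j<n. j \<noteq> k \<longrightarrow> (\<Sum>i<n. B $$ (i, j) * B $$ (i, k)) = 0) \<and>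
      (\<forall>k<n. (\<Sum>i<n. (B $$ (i, k))\<^sup>2) \<le> (\<Sum>i<n. (A $$ (i, k))\<^sup>2))" if "m \<le> n" for m
    using that
  proof (induction m)
    case 0
    then show ?case
      using A by (intro exI[of _ A]) auto
  next
    case (Suc m)
    then obtain B where B: "B \<in> carrier_mat n n" "det B = det A"
      and orth: "\<And>k j. k < m \<Longrightarrow> j < n \<Longrightarrow> j \<noteq> k \<Longrightarrow> (\<Sum>i<n. B $$ (i, j) * B $$ (i, k)) = 0"
      and le: "\<And>k. k < n \<Longrightarrow> (\<Sum>i<n. (B $$ (i, k))\<^sup>2) \<le> (\<Sum>i<n. (A $$ (i, k))\<^sup>2)"
      by auto
    have m: "m < n"
      using Suc.prems by simp
    obtain C where C: "C \<in> carrier_mat n n" "det C = det B"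
      and eq: "\<And>i j. i < n \<Longrightarrow> j < n \<Longrightarrow> j \<noteq> m \<Longrightarrow> C $$ (i, j) = B $$ (i, j)"
      and orth': "\<And>j. j < n \<Longrightarrow> j \<noteq> m \<Longrightarrow> (\<Sum>i<n. C $$ (i, j) * C $$ (i, m)) = 0"
      and le': "(\<Sum>i<n. (C $$ (i, m))\<^sup>2) \<le> (\<Sum>i<n. (B $$ (i, m))\<^sup>2)"
      using orthogonalize_column[OF B(1) m] B(2) False by auto
    have "(\<Sum>i<n. C $$ (i, j) * C $$ (i, k)) = 0" if "k < Suc m" "j < n" "j \<noteq> k" for k j
    \<comment> \<open>Pairs involving the new column \<open>m\<close> are orthogonal by
      construction; all other pairs are inherited from \<open>B\<close>.\<close>
    proof (cases "k = m \<or> j = m")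
      case True
      then show ?thesis
        using orth' that m by (metis (no_types, lifting) less_trans less_Suc_eq mult.commute sum.cong)
    next
      case False
      then have "(\<Sum>i<n. C $$ (i, j) * C $$ (i, k)) = (\<Sum>i<n. B $$ (i, j) * B $$ (i, k))"
        using that m by (intro sum.cong) (auto simp: eq)
      then show ?thesis
        using orth that False by simp
    qed
    moreover have "(\<Sum>i<n. (C $$ (i, k))\<^sup>2) \<le> (\<Sum>i<n. (A $$ (i, k))\<^sup>2)" if "k < n" for k
    proof (cases "k = m")
      case True
      then show ?thesis
        using le' le[OF m] by simp
    next
      case False
      then show ?thesis
        using le[OF that] that by (simp add: eq)
    qed
    ultimately show ?case
      using B C by (intro exI[of _ C]) auto
  qed
  from this[of n] obtain B where B: "B \<in> carrier_mat n n" "det B = det A"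
    and orth: "\<And>k j. k < n \<Longrightarrow> j < n \<Longrightarrow> j \<noteq> k \<Longrightarrow> (\<Sum>i<n. B $$ (i, j) * B $$ (i, k)) = 0"
    and le: "\<And>k. k < n \<Longrightarrow> (\<Sum>i<n. (B $$ (i, k))\<^sup>2) \<le> (\<Sum>i<n. (A $$ (i, k))\<^sup>2)"
    by auto
  have entry: "(B\<^sup>T * B) $$ (j, k) = (\<Sum>i<n. B $$ (i, j) * B $$ (i, k))"
    if "j < n" "k < n" for j k
    using B(1) that by (simp add: scalar_prod_def lessThan_atLeast0)
  have BB: "B\<^sup>T * B \<in> carrier_mat n n"
    using B(1) by auto
  have "(det B)\<^sup>2 = det (B\<^sup>T * B)"
    using B(1) by (simp add: det_mult[of _ n] det_transpose[of _ n] power2_eq_square)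
  also have "\<dots> = prod_list (diag_mat (B\<^sup>T * B))"
    using orth BB by (intro det_upper_triangular[of _ n])
      (auto simp: upper_triangular_def entry simp del: index_mult_mat(1))
  also have "\<dots> = (\<Prod>k<n. \<Sum>i<n. (B $$ (i, k))\<^sup>2)"
    using B(1) by (simp add: prod_list_diag_prod entry power2_eq_square lessThan_atLeast0
        del: index_mult_mat(1))
  also have "\<dots> \<le> (\<Prod>k<n. \<Sum>i<n. (A $$ (i, k))\<^sup>2)"
    using le by (intro prod_mono) (auto simp: sum_nonneg)
  finally show ?thesis
    using B(2) by simp
qed

subsection \<open>The sufficiently scattered condition\<close>

text \<open>The dual of the SSC1 cone is contained in \<open>C_star r\<close>. Split
  \<open>y\<close> into \<open>s / r\<close> times the all-ones vector and a part \<open>v\<close>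
  orthogonal to it. With \<open>n\<close> the length of \<open>v\<close>, the claim follows from
  \<open>0 \<le> s\<close> and \<open>c * n \<le> s\<close>, which come from testing
  \<open>y\<close> against two vectors of the primal cone.\<close>

lemma norm_le_sum_of_dual:
  fixes y :: "nat \<Rightarrow> real"
  assumes r: "r \<ge> 2"
    and dual: "\<And>x. (\<And>i. i < r \<Longrightarrow> 0 \<le> x i) \<Longrightarrow>
      sqrt (real r - 1) * L2_set x {..<r} \<le> sum x {..<r} \<Longrightarrow> 0 \<le> (\<Sum>i<r. y i * x i)"
  shows "L2_set y {..<r} \<le> sum y {..<r}"
proof -
  define s where "s = sum y {..<r}"
  define v where "v i = y i - s / r" for i
  define n where "n = L2_set v {..<r}"
  \<comment> \<open>The value that puts \<open>n e - c v\<close> on the boundary of the primal cone,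
    \<open>e\<close> being the all-ones vector.\<close>
  define c where "c = sqrt (real r / (real r - 1))"
  have n2: "n\<^sup>2 = (\<Sum>i<r. (v i)\<^sup>2)" and n0: "0 \<le> n"
    by (simp_all add: n_def L2_set_def sum_nonneg)
  have c2: "c\<^sup>2 = real r / (real r - 1)" and c0: "0 \<le> c"
    using r by (simp_all add: c_def)
  have sumv: "sum v {..<r} = 0"
    using r by (simp add: v_def sum_subtractf s_def)
  have v_lin: "(\<Sum>i<r. a * v i) = 0" for a
    using sumv by (simp flip: sum_distrib_left)
  have sumy2: "(\<Sum>i<r. (y i)\<^sup>2) = n\<^sup>2 + s\<^sup>2 / r"
  proof -
    define t where "t = s / r"
    have "(\<Sum>i<r. (y i)\<^sup>2) = (\<Sum>i<r. (v i)\<^sup>2 + t\<^sup>2 + 2 * t * v i)"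
      by (intro sum.cong) (auto simp: v_def t_def[symmetric] power2_diff power2_eq_square algebra_simps)
    also have "\<dots> = n\<^sup>2 + r * t\<^sup>2"
      by (simp add: sum.distrib n2 v_lin)
    finally show ?thesis
      using r by (simp add: t_def power2_eq_square)
  qed
  \<comment> \<open>Tested separately with the all-ones vector, because for \<open>n = 0\<close> the
    extremal test vector is zero and says nothing.\<close>
  have s0: "0 \<le> s"
  proof -
    have "sqrt (real r - 1) * sqrt (real r) \<le> sqrt (real r) * sqrt (real r)"
      using r by (intro mult_right_mono) auto
    then show ?thesis
      using dual[of "\<lambda>_. 1"] r by (simp add: L2_set_def s_def)
  qed
  \<comment> \<open>Nonnegativity of the extremal test vector. The entries of \<open>v\<close> sum
    to zero, so \<open>v i\<close> is minus the sum of the other \<open>r - 1\<close> entries, and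
    Cauchy-Schwarz bounds that sum by what remains of \<open>n\<^sup>2\<close>.\<close>
  have v_le: "c * v i \<le> n" if i: "i < r" for i
  proof -
    have split: "sum f {..<r} = f i + sum f ({..<r} - {i})" for f :: "nat \<Rightarrow> real"
      using i by (intro sum.remove) auto
    have "v i = - sum v ({..<r} - {i})"
      using split[of v] sumv by simp
    then have "(v i)\<^sup>2 = (\<Sum>j\<in>{..<r} - {i}. v j * 1)\<^sup>2"
      by simp
    also have "\<dots> \<le> (\<Sum>j\<in>{..<r} - {i}. (v j)\<^sup>2) * (\<Sum>j\<in>{..<r} - {i}. 1\<^sup>2)"
      by (rule Cauchy_Schwarz_ineq_sum)
    also have "\<dots> = (n\<^sup>2 - (v i)\<^sup>2) * (real r - 1)"
      using split[of "\<lambda>j. (v j)\<^sup>2"] i by (simp add: n2 of_nat_diff)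
    finally have "real r * (v i)\<^sup>2 \<le> n\<^sup>2 * (real r - 1)"
      by (simp add: algebra_simps)
    then have "(c * v i)\<^sup>2 \<le> n\<^sup>2"
      using r by (simp add: power_mult_distrib c2 field_simps)
    then show ?thesis
      using n0 by (rule power2_le_imp_le)
  qed
  have sq: "(\<Sum>i<r. (n - c * v i)\<^sup>2) * (real r - 1) = (n * r)\<^sup>2"
  proof -
    have "(\<Sum>i<r. (n - c * v i)\<^sup>2) = (\<Sum>i<r. n\<^sup>2 - 2 * n * c * v i + c\<^sup>2 * (v i)\<^sup>2)"
      by (intro sum.cong) (auto simp: power2_eq_square algebra_simps)
    also have "\<dots> = r * n\<^sup>2 + c\<^sup>2 * n\<^sup>2"
      using sumv by (simp add: sum.distrib sum_subtractf n2 flip: sum_distrib_left)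
    finally have "(\<Sum>i<r. (n - c * v i)\<^sup>2) * (real r - 1) = n\<^sup>2 * ((real r + c\<^sup>2) * (real r - 1))"
      by (simp only: distrib_left distrib_right mult_ac)
    also have "(real r + c\<^sup>2) * (real r - 1) = (real r)\<^sup>2"
      unfolding c2 using r by (simp add: field_simps power2_eq_square)
    finally show ?thesis
      by (simp add: power_mult_distrib)
  qed
  \<comment> \<open>\<open>n e - c v\<close> is the point of the primal cone making the largest angle with \<open>y\<close>.\<close>
  have "0 \<le> (\<Sum>i<r. y i * (n - c * v i))"
  proof (rule dual)
    have "sqrt (real r - 1) * L2_set (\<lambda>i. n - c * v i) {..<r} = n * r"
      using sq n0 by (simp add: L2_set_def mult.commute flip: real_sqrt_mult)
    also have "\<dots> = (\<Sum>i<r. n - c * v i)"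
      using sumv by (simp add: sum_subtractf flip: sum_distrib_left)
    finally show "sqrt (real r - 1) * L2_set (\<lambda>i. n - c * v i) {..<r} \<le> (\<Sum>i<r. n - c * v i)"
      by simp
  qed (use v_le in simp)
  also have "\<dots> = (\<Sum>i<r. n * y i - c * (v i)\<^sup>2 - c * s / r * v i)"
    by (intro sum.cong) (auto simp: v_def power2_eq_square field_simps)
  also have "\<dots> = (\<Sum>i<r. n * y i) - (\<Sum>i<r. c * (v i)\<^sup>2) - (\<Sum>i<r. c * s / r * v i)"
    by (simp only: sum_subtractf)
  also have "\<dots> = n * s - c * n\<^sup>2"
    by (simp only: v_lin n2 s_def sumv mult_zero_right diff_zero flip: sum_distrib_left)
  also have "\<dots> = n * (s - c * n)"
    by (simp add: power2_eq_square algebra_simps)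
  finally have "c * n \<le> s"
    using n0 s0 by (cases "n = 0") (auto simp: zero_le_mult_iff)
  then have "(c * n)\<^sup>2 \<le> s\<^sup>2"
    using c0 n0 by (intro power_mono) auto
  then have "real r * n\<^sup>2 \<le> s\<^sup>2 * (real r - 1)"
    using r by (simp add: power_mult_distrib c2 field_simps)
  then have "n\<^sup>2 + s\<^sup>2 / r \<le> s\<^sup>2"
    using r by (simp add: field_simps)
  then show ?thesis
    using s0 by (simp add: L2_set_def sumy2 real_le_lsqrt flip: s_def)
qed

lemma ones_scalar_prod: "x \<in> carrier_vec r \<Longrightarrow> ones_vec r \<bullet> x = (\<Sum>i<r. x $ i)"
  by (auto simp: ones_vec_def scalar_prod_def lessThan_atLeast0)

lemma transpose_ones_eq_iff:
  assumes "A \<in> carrier_mat n r"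
  shows "A\<^sup>T *\<^sub>v ones_vec n = ones_vec r \<longleftrightarrow> (\<forall>k<r. (\<Sum>i<n. A $$ (i, k)) = 1)"
  using assms
  by (auto simp: vec_eq_iff ones_vec_def scalar_prod_def lessThan_atLeast0 carrier_matD)

lemma nonneg_mat_iff: "nonneg_mat A \<longleftrightarrow> (\<forall>i<dim_row A. \<forall>j<dim_col A. 0 \<le> A $$ (i, j))"
  by (simp add: nonneg_mat_def less_eq_mat_def)

text \<open>Dualizing reverses the inclusion: each \<open>x\<close> in the SSC1 cone is
  \<open>H\<^sup>T *\<^sub>v z\<close> with \<open>z\<close> nonnegative, so its product with
  \<open>y\<close> equals that of \<open>z\<close> with \<open>H *\<^sub>v y\<close> and is
  nonnegative.\<close>

lemma SSC1_imp_C_star: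
  assumes H: "H \<in> carrier_mat n r" "SSC1 H" and r: "r \<ge> 2"
    and y: "y \<in> carrier_vec r" "0\<^sub>v n \<le> H *\<^sub>v y"
  shows "y \<in> C_star r"
proof -
  have "L2_set (\<lambda>i. y $ i) {..<r} \<le> (\<Sum>i<r. y $ i)"
  proof (rule norm_le_sum_of_dual[OF r])
    fix x :: "nat \<Rightarrow> real"
    assume x: "\<And>i. i < r \<Longrightarrow> 0 \<le> x i" "sqrt (real r - 1) * L2_set x {..<r} \<le> sum x {..<r}"
    have "norm_vec (vec r x) = L2_set x {..<r}"
      by (auto simp: norm_vec_def intro!: L2_set_cong)
    then have "vec r x \<in> {x \<in> carrier_vec r. 0\<^sub>v r \<le> x \<and> ones_vec r \<bullet> x \<ge> sqrt (real r - 1) * norm_vec x}"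
      using x by (simp add: ones_scalar_prod less_eq_vec_def)
    then have "vec r x \<in> cone (H\<^sup>T)"
      using H by (auto simp: SSC1_def Let_def)
    then obtain z where z: "z \<in> carrier_vec n" "0\<^sub>v n \<le> z" "vec r x = H\<^sup>T *\<^sub>v z"
      using H(1) by (auto simp: cone_def)
    have "(\<Sum>i<r. y $ i * x i) = y \<bullet> (H\<^sup>T *\<^sub>v z)"
      using y(1) by (simp add: scalar_prod_def lessThan_atLeast0 flip: z(3))
    also have "\<dots> = z \<bullet> (H *\<^sub>v y)"
      using H(1) y(1) z(1) by (metis comm_scalar_prod mult_mat_vec_carrier transpose_carrier_mat
          transpose_vec_mult_scalar)
    also have "\<dots> \<ge> 0"
      using H(1) y z by (auto simp: scalar_prod_def less_eq_vec_def intro!: sum_nonneg mult_nonneg_nonneg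
          simp del: index_mult_mat_vec)
    finally show "0 \<le> (\<Sum>i<r. y $ i * x i)" .
  qed
  then show ?thesis
    using y(1) by (simp add: C_star_def ones_scalar_prod norm_vec_def)
qed

text \<open>Subtracting a small \<open>e\<close> from every entry lowers the entry sum by
  \<open>r * e\<close> but the norm by at most \<open>e * sqrt r\<close>, which is less since
  \<open>r \<ge> 2\<close>. Hence points outside the cone lie arbitrarily close to
  \<open>y\<close>.\<close>

lemma boundary_C_star:
  assumes r: "r \<ge> 2" and y: "y \<in> carrier_vec r" "ones_vec r \<bullet> y = norm_vec y"
  shows "y \<in> boundary r (C_star r)"
proof -
  interpret Metric_space "carrier_vec r" "dist_vec r"
    by (rule Metric_space_vec)
  have "y \<in> C_star r"
    using y by (simp add: C_star_def)
  moreover have "C_star r \<subseteq> topspace mtopology"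
    by (auto simp: C_star_def)
  ultimately have "y \<in> mtopology closure_of C_star r"
    using closure_of_subset by blast
  moreover have "y \<notin> mtopology interior_of C_star r"
  proof
    assume "y \<in> mtopology interior_of C_star r"
    then obtain U where "openin mtopology U" "y \<in> U" "U \<subseteq> C_star r"
      by (auto simp: interior_of_def)
    then obtain d where d: "d > 0" "mball y d \<subseteq> C_star r"
      unfolding openin_mtopology by blast
    \<comment> \<open>Gives the shift length \<open>d / 2\<close>, so that the shifted point stays
      in the ball.\<close>
    define e where "e = d / (2 * sqrt r)"
    have e: "0 < e" "e * sqrt r < d"
      using d r by (auto simp: e_def)
    define x where "x = vec r (\<lambda>i. y $ i - e)"
    have L2e: "L2_set (\<lambda>i. e) {..<r} = e * sqrt r"
      using e by (simp add: L2_set_def real_sqrt_mult)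
    have "dist_vec r y x = L2_set (\<lambda>i. e) {..<r}"
      unfolding dist_vec_def by (intro L2_set_cong) (auto simp: x_def)
    then have "x \<in> mball y d"
      using y e by (simp add: L2e x_def in_mball)
    then have "x \<in> C_star r"
      using d by blast
    moreover have "norm_vec x = L2_set (\<lambda>i. y $ i - e) {..<r}"
      by (auto simp: norm_vec_def x_def intro!: L2_set_cong)
    moreover have "ones_vec r \<bullet> x = (\<Sum>i<r. y $ i - e)"
      by (subst ones_scalar_prod) (auto simp: x_def)
    ultimately have "L2_set (\<lambda>i. y $ i - e) {..<r} \<le> (\<Sum>i<r. y $ i - e)"
      by (simp add: C_star_def)
    moreover have "L2_set (\<lambda>i. y $ i - e + e) {..<r} \<le> L2_set (\<lambda>i. y $ i - e) {..<r} + e * sqrt r"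
      unfolding L2e[symmetric] by (rule L2_set_triangle_ineq)
    ultimately have "real r * e \<le> e * sqrt r"
      using y by (simp add: ones_scalar_prod norm_vec_def sum_subtractf)
    moreover have "sqrt r < r"
      using r by (intro real_less_lsqrt) (auto simp: power2_eq_square)
    ultimately show False
      using e by simp
  qed
  ultimately show ?thesis
    by (simp add: boundary_def frontier_of_def)
qed

text \<open>A kernel vector and its negative both lie in \<open>C_star r\<close>, a cone that
  contains no line: the norm is at most the entry sum and at most its negative.\<close>

lemma SSC_inj:
  assumes H: "H \<in> carrier_mat n r" "SSC H"
    and y: "y \<in> carrier_vec r" "H *\<^sub>v y = 0\<^sub>v n"
  shows "y = 0\<^sub>v r"
proof -
  have r: "r \<ge> 2" and "SSC1 H"
    using H by (auto simp: SSC_def)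
  have "H *\<^sub>v (- y) = 0\<^sub>v n"
    using H(1) y by (auto simp: vec_eq_iff)
  then have "y \<in> C_star r" "- y \<in> C_star r"
    using H y r \<open>SSC1 H\<close> by (auto intro!: SSC1_imp_C_star)
  then have "L2_set (\<lambda>i. y $ i) {..<r} \<le> (\<Sum>i<r. y $ i)" "L2_set (\<lambda>i. y $ i) {..<r} \<le> - (\<Sum>i<r. y $ i)"
    using y(1) by (auto simp: C_star_def ones_scalar_prod norm_vec_def L2_set_def sum_negf)
  then have "L2_set (\<lambda>i. y $ i) {..<r} = 0"
    using L2_set_nonneg[of "\<lambda>i. y $ i" "{..<r}"] by linarith
  then show ?thesis
    using y(1) by (auto simp: L2_set_eq_0_iff)
qed

text \<open>Injectivity makes the Gram matrix \<open>H\<^sup>T * H\<close> invertible; its inverse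
  times \<open>H\<^sup>T\<close> is the left inverse.\<close>

lemma SSC_left_inverse:
  assumes H: "H \<in> carrier_mat n r" "SSC H"
  obtains L where "L \<in> carrier_mat r n" "L * H = 1\<^sub>m r"
proof -
  have HH: "H\<^sup>T * H \<in> carrier_mat r r"
    using H(1) by simp
  have "det (H\<^sup>T * H) \<noteq> 0"
  proof
    assume "det (H\<^sup>T * H) = 0"
    then obtain v where v: "v \<in> carrier_vec r" "v \<noteq> 0\<^sub>v r" "(H\<^sup>T * H) *\<^sub>v v = 0\<^sub>v r"
      using det_0_iff_vec_prod_zero_field[OF HH] by blast
    have Hv: "H *\<^sub>v v \<in> carrier_vec n"
      using H(1) v(1) by simp
    have "H\<^sup>T *\<^sub>v (H *\<^sub>v v) = 0\<^sub>v r"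
      using H(1) v by (metis assoc_mult_mat_vec transpose_carrier_mat)
    then have "(H *\<^sub>v v) \<bullet> (H *\<^sub>v v) = 0"
      using H(1) v(1) Hv by (metis scalar_prod_left_zero transpose_vec_mult_scalar)
    then have "H *\<^sub>v v = 0\<^sub>v n"
      using Hv H(1) by (intro eq_vecI) (auto simp: scalar_prod_def sum_nonneg_eq_0_iff simp del: index_mult_mat_vec)
    then show False
      using SSC_inj[OF H] v by blast
  qed
  then obtain B where B: "B \<in> carrier_mat r r" "B * (H\<^sup>T * H) = 1\<^sub>m r"
    using det_non_zero_imp_unit[OF HH] by (auto simp: Units_def ring_mat_def)
  show ?thesis
  proof
    show "B * H\<^sup>T \<in> carrier_mat r n" "B * H\<^sup>T * H = 1\<^sub>m r"
      using B H(1) by auto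
  qed
qed

section \<open>Permutation matrices\<close>

text \<open>\<open>permutes\<close> demands the identity outside the index range, so an injective
  self-map of the range is patched there.\<close>

lemma permutes_extend:
  fixes f :: "nat \<Rightarrow> nat"
  assumes "inj_on f {..<n}" "f \<in> {..<n} \<rightarrow> {..<n}"
  shows "(\<lambda>i. if i < n then f i else i) permutes {..<n}"
proof -
  have "f ` {..<n} = {..<n}"
    using assms by (intro endo_inj_surj) auto
  then have "bij_betw f {..<n} {..<n}"
    using assms by (simp add: bij_betw_def)
  then have "bij_betw (\<lambda>i. if i < n then f i else i) {..<n} {..<n}"
    by (subst bij_betw_cong[where g = f]) auto
  then show ?thesis
    by (rule bij_imp_permutes) auto
qed

text \<open>With this convention right multiplication, and left multiplication by the transpose,
  reindex by \<open>\<pi>\<close> itself and not by its inverse.\<close>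

definition perm_mat :: "nat \<Rightarrow> (nat \<Rightarrow> nat) \<Rightarrow> real mat" where
  "perm_mat n \<pi> = mat n n (\<lambda>(i, j). if i = \<pi> j then 1 else 0)"

lemma permutation_mat_iff: "permutation_mat n P \<longleftrightarrow> (\<exists>\<pi>. \<pi> permutes {..<n} \<and> P = perm_mat n \<pi>)"
  by (simp add: permutation_mat_def perm_mat_def)

lemma perm_mat_carrier [simp]:
  "perm_mat n \<pi> \<in> carrier_mat n n" "dim_row (perm_mat n \<pi>) = n" "dim_col (perm_mat n \<pi>) = n"
  by (simp_all add: perm_mat_def)

lemma permutation_matI:
  assumes "inj_on f {..<n}" "f \<in> {..<n} \<rightarrow> {..<n}"
    and "P \<in> carrier_mat n n" "\<And>i j. i < n \<Longrightarrow> j < n \<Longrightarrow> P $$ (i, j) = (if i = f j then 1 else 0)"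
  shows "permutation_mat n P"
  unfolding permutation_mat_iff
proof (intro exI conjI)
  show "(\<lambda>i. if i < n then f i else i) permutes {..<n}"
    by (rule permutes_extend) fact+
  show "P = perm_mat n (\<lambda>i. if i < n then f i else i)"
    using assms by (intro eq_matI) (auto simp: perm_mat_def)
qed

text \<open>The columns of \<open>A\<close> have entry sum 1 because \<open>H\<close> and
  \<open>H * A\<close> both have unit column sums, and nonnegativity of \<open>H * A\<close> puts
  them in the dual cone. Hadamard's bound becomes a product of factors at most 1, so a determinant
  of modulus 1 leaves no slack in any factor.\<close>

lemma SSC_stochastic_factor:
  assumes H: "H \<in> carrier_mat n r" "SSC H" "H\<^sup>T *\<^sub>v ones_vec n = ones_vec r"
    and A: "A \<in> carrier_mat r r"
    and HA: "nonneg_mat (H * A)" "(H * A)\<^sup>T *\<^sub>v ones_vec n = ones_vec r"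
  shows SSC_det_le: "\<bar>det A\<bar> \<le> 1"
    and SSC_det_eq: "\<bar>det A\<bar> = 1 \<Longrightarrow> permutation_mat r A"
proof -
  have r: "r \<ge> 2" and "SSC1 H" "SSC2 H"
    using H by (auto simp: SSC_def)
  have HAc: "H * A \<in> carrier_mat n r"
    using H A by simp
  have entry: "(H * A) $$ (i, k) = (\<Sum>j<r. H $$ (i, j) * A $$ (j, k))" if "i < n" "k < r" for i k
    using H A that by (simp add: scalar_prod_def lessThan_atLeast0)
  have A1: "(\<Sum>j<r. A $$ (j, k)) = 1" if k: "k < r" for k
  proof -
    have "(\<Sum>j<r. A $$ (j, k)) = (\<Sum>j<r. (\<Sum>i<n. H $$ (i, j)) * A $$ (j, k))"
      using H by (simp add: transpose_ones_eq_iff)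
    also have "\<dots> = (\<Sum>j<r. \<Sum>i<n. H $$ (i, j) * A $$ (j, k))"
      by (simp add: sum_distrib_right)
    also have "\<dots> = (\<Sum>i<n. \<Sum>j<r. H $$ (i, j) * A $$ (j, k))"
      by (rule sum.swap)
    also have "\<dots> = (\<Sum>i<n. (H * A) $$ (i, k))"
      using entry k by simp
    also have "\<dots> = 1"
      using HA(2) k HAc by (simp only: transpose_ones_eq_iff)
    finally show ?thesis .
  qed
  have cone: "0\<^sub>v n \<le> H *\<^sub>v col A k" if "k < r" for k
    using HA(1) H A that by (auto simp: nonneg_mat_iff less_eq_vec_def)
  have norm: "norm_vec (col A k) \<le> 1" if "k < r" for k
    using SSC1_imp_C_star[OF H(1) \<open>SSC1 H\<close> r _ cone[OF that]] A that A1[OF that]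
    by (simp add: C_star_def ones_scalar_prod)
  have norm2: "(norm_vec (col A k))\<^sup>2 = (\<Sum>i<r. (A $$ (i, k))\<^sup>2)" if "k < r" for k
    using A that by (simp add: norm_vec_def L2_set_def sum_nonneg)
  have norm0: "0 \<le> norm_vec x" for x
    by (simp add: norm_vec_def)
  have le1: "(\<Sum>i<r. (A $$ (i, k))\<^sup>2) \<le> 1" if "k < r" for k
    using norm[OF that] norm0[of "col A k"] by (simp add: power_le_one flip: norm2[OF that])
  have hada: "(det A)\<^sup>2 \<le> (\<Prod>k<r. \<Sum>i<r. (A $$ (i, k))\<^sup>2)"
    by (rule Hadamard_inequality[OF A])
  also have "\<dots> \<le> 1"
    using le1 by (intro prod_le_1) (auto simp: sum_nonneg)
  finally show "\<bar>det A\<bar> \<le> 1"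
    by (simp add: abs_square_le_1)
  assume det1: "\<bar>det A\<bar> = 1"
  have norm1: "norm_vec (col A k) = 1" if k: "k < r" for k
  proof -
    have "1 \<le> (\<Prod>k<r. \<Sum>i<r. (A $$ (i, k))\<^sup>2)"
      using hada det1 by (metis one_power2 power2_abs)
    \<comment> \<open>Split off factor \<open>k\<close>: the others contribute at most 1, so this
      one must reach 1 by itself.\<close>
    also have "\<dots> = (\<Sum>i<r. (A $$ (i, k))\<^sup>2) * (\<Prod>l\<in>{..<r} - {k}. \<Sum>i<r. (A $$ (i, l))\<^sup>2)"
      using k by (intro prod.remove) auto
    also have "\<dots> \<le> (\<Sum>i<r. (A $$ (i, k))\<^sup>2) * 1"
      using le1 by (intro mult_left_mono prod_le_1) (auto simp: sum_nonneg)
    finally have "(norm_vec (col A k))\<^sup>2 = 1"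
      using le1[OF k] norm2[OF k] by simp
    then show ?thesis
      using norm0[of "col A k"] by (simp add: power2_eq_1_iff)
  qed
  have "\<exists>j<r. col A k = unit_vec r j" if k: "k < r" for k
  proof -
    have "col A k \<in> boundary r (C_star r)"
      using A k A1 norm1[OF k] by (intro boundary_C_star[OF r]) (auto simp: ones_scalar_prod)
    moreover have "col A k \<in> dual_cone (H\<^sup>T)"
      using A H(1) cone[OF k] by (auto simp: dual_cone_def intro: carrier_vecI)
    moreover have "dual_cone (H\<^sup>T) \<inter> boundary r (C_star r) = {c \<cdot>\<^sub>v unit_vec r k | c k. 0 \<le> c \<and> k < r}"
      using \<open>SSC2 H\<close> H(1) by (simp add: SSC2_def Let_def)
    ultimately obtain c j where cj: "col A k = c \<cdot>\<^sub>v unit_vec r j" "j < r"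
      by blast
    \<comment> \<open>The entry sum fixes the scalar that SSC2 leaves free.\<close>
    have "1 = (\<Sum>i<r. col A k $ i)"
      using A1[OF k] A k by simp
    also have "\<dots> = c"
      using cj(2) by (simp add: cj(1) unit_vec_def if_distrib cong: if_cong)
    finally show ?thesis
      using cj by auto
  qed
  then obtain f where f: "\<And>k. k < r \<Longrightarrow> f k < r \<and> col A k = unit_vec r (f k)"
    by metis
  show "permutation_mat r A"
  proof (rule permutation_matI)
    \<comment> \<open>A repeated value would give two equal columns and determinant zero.\<close>
    show "inj_on f {..<r}"
      using f det1 det_identical_columns[OF A] by (intro inj_onI) (metis abs_0 lessThan_iff zero_neq_one)
    show "A $$ (i, j) = (if i = f j then 1 else 0)" if "i < r" "j < r" for i j
    proof -
      have "A $$ (i, j) = col A j $ i"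
        using A that by simp
      then show ?thesis
        using f[OF that(2)] that by (simp add: unit_vec_def)
    qed
  qed (use f A in auto)
qed

subsection \<open>Kronecker products, unfoldings and permutation matrices\<close>

lemma sum_pair_index:
  fixes f :: "nat \<Rightarrow> 'a :: comm_monoid_add"
  shows "(\<Sum>p<m * n. f p) = (\<Sum>i<m. \<Sum>j<n. f (i + j * m))"
proof -
  have "(\<Sum>p<m * n. f p) = (\<Sum>(i, j)\<in>{..<m} \<times> {..<n}. f (i + j * m))"
  proof (intro sum.reindex_bij_witness[of _ "\<lambda>(i, j). i + j * m" "\<lambda>p. (p mod m, p div m)"])
    fix p
    assume "p \<in> {..<m * n}"
    then have "0 < m" "p < n * m"
      by (auto simp: mult.commute intro: ccontr)
    then show "(p mod m, p div m) \<in> {..<m} \<times> {..<n}"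
      by (simp add: less_mult_imp_div_less)
  qed (auto simp: pair_index_less)
  then show ?thesis
    by (simp add: sum.cartesian_product)
qed

lemma kron_carrier:
  assumes "A \<in> carrier_mat m M" "B \<in> carrier_mat n N"
  shows "A \<otimes>\<^sub>k B \<in> carrier_mat (m * n) (M * N)"
  using assms by (simp add: kron_def)

lemma unfold3_carrier [simp]: "unfold3 n1 n2 n3 T \<in> carrier_mat (n1 * n2) n3"
  by (simp add: unfold3_def)

lemma pair_indexE:
  fixes p :: nat
  assumes "p < m * n"
  obtains i j where "i < m" "j < n" "p = i + j * m"
proof
  have "0 < m" "p < n * m"
    using assms by (auto simp: mult.commute intro: ccontr)
  then show "p mod m < m" "p div m < n" "p = p mod m + p div m * m"
    by (simp_all add: less_mult_imp_div_less)
qed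

text \<open>Reduces the tensor identity to a product of three matrices. Row
  \<open>j1 + j2 * n1\<close> of the Kronecker product holds the products
  \<open>U1 $$ (j1, i1) * U2 $$ (j2, i2)\<close>, so splitting the summation index into a pair
  produces the triple sum.\<close>

lemma unfold3_multilinear_mult:
  assumes U: "U1 \<in> carrier_mat n1 r1" "U2 \<in> carrier_mat n2 r2" "U3 \<in> carrier_mat n3 r3"
  shows "unfold3 n1 n2 n3 (multilinear_mult U1 U2 U3 G)
    = (U1 \<otimes>\<^sub>k U2) * unfold3 r1 r2 r3 G * U3\<^sup>T"
proof (rule eq_matI)
  note W = kron_carrier[OF U(1,2)]
  fix p k
  assume "p < dim_row ((U1 \<otimes>\<^sub>k U2) * unfold3 r1 r2 r3 G * U3\<^sup>T)"
    and "k < dim_col ((U1 \<otimes>\<^sub>k U2) * unfold3 r1 r2 r3 G * U3\<^sup>T)"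
  then have p: "p < n1 * n2" and k: "k < n3"
    using W U by auto
  obtain j1 j2 where j: "j1 < n1" "j2 < n2" "p = j1 + j2 * n1"
    using p by (rule pair_indexE)
  have W_entry: "(U1 \<otimes>\<^sub>k U2) $$ (p, i1 + i2 * r1) = U1 $$ (j1, i1) * U2 $$ (j2, i2)"
    if "i1 < r1" "i2 < r2" for i1 i2
    using index_kron[of j1 U1 j2 U2 i1 i2] j that U by simp
  have "((U1 \<otimes>\<^sub>k U2) * unfold3 r1 r2 r3 G * U3\<^sup>T) $$ (p, k)
      = (\<Sum>i3<r3. (\<Sum>q<r1 * r2. (U1 \<otimes>\<^sub>k U2) $$ (p, q) * unfold3 r1 r2 r3 G $$ (q, i3)) * U3 $$ (k, i3))"
    using W U p k by (simp add: scalar_prod_def lessThan_atLeast0 unfold3_def)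
  also have "\<dots> = (\<Sum>i3<r3. \<Sum>i1<r1. \<Sum>i2<r2. U1 $$ (j1, i1) * U2 $$ (j2, i2) * U3 $$ (k, i3) * G i1 i2 i3)"
    by (auto simp: sum_pair_index W_entry index_unfold3 sum_distrib_left sum_distrib_right mult_ac
        intro!: sum.cong)
  also have "\<dots> = (\<Sum>i1<r1. \<Sum>i3<r3. \<Sum>i2<r2. U1 $$ (j1, i1) * U2 $$ (j2, i2) * U3 $$ (k, i3) * G i1 i2 i3)"
    by (rule sum.swap)
  also have "\<dots> = (\<Sum>i1<r1. \<Sum>i2<r2. \<Sum>i3<r3. U1 $$ (j1, i1) * U2 $$ (j2, i2) * U3 $$ (k, i3) * G i1 i2 i3)"
    by (intro sum.cong refl sum.swap)
  also have "\<dots> = unfold3 n1 n2 n3 (multilinear_mult U1 U2 U3 G) $$ (p, k)"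
    using j k U by (simp add: index_unfold3) (simp add: multilinear_mult_def)
  finally show "unfold3 n1 n2 n3 (multilinear_mult U1 U2 U3 G) $$ (p, k)
      = ((U1 \<otimes>\<^sub>k U2) * unfold3 r1 r2 r3 G * U3\<^sup>T) $$ (p, k)"
    by simp
qed (use U kron_carrier[OF U(1,2)] in \<open>auto simp: unfold3_def\<close>)

lemma mult_perm_mat_index:
  assumes "A \<in> carrier_mat m n" "\<pi> permutes {..<n}" "i < m" "j < n"
  shows "(A * perm_mat n \<pi>) $$ (i, j) = A $$ (i, \<pi> j)"
proof -
  have "\<pi> j < n"
    using assms permutes_in_image[of \<pi> "{..<n}" j] by simp
  then show ?thesis
    using assms by (simp add: perm_mat_def scalar_prod_def if_distrib cong: if_cong)
qed

lemma transpose_perm_mat_mult_index: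
  assumes "A \<in> carrier_mat n m" "\<pi> permutes {..<n}" "i < n" "j < m"
  shows "((perm_mat n \<pi>)\<^sup>T * A) $$ (i, j) = A $$ (\<pi> i, j)"
proof -
  have "\<pi> i < n"
    using assms permutes_in_image[of \<pi> "{..<n}" i] by simp
  then show ?thesis
    using assms by (simp add: perm_mat_def scalar_prod_def if_distribR if_distrib cong: if_cong)
qed

lemma perm_mat_mult:
  assumes "\<pi> permutes {..<n}" "\<rho> permutes {..<n}"
  shows "perm_mat n \<pi> * perm_mat n \<rho> = perm_mat n (\<pi> \<circ> \<rho>)"
proof (rule eq_matI)
  fix i j
  assume "i < dim_row (perm_mat n (\<pi> \<circ> \<rho>))" "j < dim_col (perm_mat n (\<pi> \<circ> \<rho>))"
  then have ij: "i < n" "j < n"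
    by (auto simp: perm_mat_def)
  then have "\<rho> j < n"
    using assms permutes_in_image[of \<rho> "{..<n}" j] by simp
  with ij show "(perm_mat n \<pi> * perm_mat n \<rho>) $$ (i, j) = perm_mat n (\<pi> \<circ> \<rho>) $$ (i, j)"
    by (subst mult_perm_mat_index[OF _ assms(2)]) (auto simp: perm_mat_def)
qed (auto simp: perm_mat_def)

lemma transpose_perm_mat_mult_self:
  assumes "\<pi> permutes {..<n}"
  shows "(perm_mat n \<pi>)\<^sup>T * perm_mat n \<pi> = 1\<^sub>m n"
proof (rule eq_matI)
  fix i j
  assume "i < dim_row (1\<^sub>m n :: real mat)" "j < dim_col (1\<^sub>m n :: real mat)"
  then have ij: "i < n" "j < n"
    by auto
  then have "\<pi> i < n"
    using assms permutes_in_image[of \<pi> "{..<n}" i] by simp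
  with ij show "((perm_mat n \<pi>)\<^sup>T * perm_mat n \<pi>) $$ (i, j) = 1\<^sub>m n $$ (i, j)"
    using permutes_inj[OF assms]
    by (subst transpose_perm_mat_mult_index[OF _ assms]) (auto simp: perm_mat_def inj_eq)
qed (auto simp: perm_mat_def)

text \<open>Summing an entry of a Kronecker product over the rows of one factor recovers the entry of the
  other, so a column \<open>(a, b)\<close> of \<open>V1 \<otimes>\<^sub>k V2\<close> determines column \<open>a\<close> of \<open>V1\<close> and column \<open>b\<close> of \<open>V2\<close>.\<close>

lemma kron_column_permutation:
  assumes U: "U1 \<in> carrier_mat n1 r1" "U2 \<in> carrier_mat n2 r2"
      "U1\<^sup>T *\<^sub>v ones_vec n1 = ones_vec r1" "U2\<^sup>T *\<^sub>v ones_vec n2 = ones_vec r2"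
    and V: "V1 \<in> carrier_mat n1 r1" "V2 \<in> carrier_mat n2 r2"
      "V1\<^sup>T *\<^sub>v ones_vec n1 = ones_vec r1" "V2\<^sup>T *\<^sub>v ones_vec n2 = ones_vec r2"
    and inj: "inj_on (col (U1 \<otimes>\<^sub>k U2)) {..<r1 * r2}"
    and pos: "0 < r1" "0 < r2"
    and \<sigma>: "\<sigma> permutes {..<r1 * r2}"
    and eq: "(U1 \<otimes>\<^sub>k U2) * perm_mat (r1 * r2) \<sigma> = V1 \<otimes>\<^sub>k V2"
  obtains \<alpha> \<beta> where "\<alpha> permutes {..<r1}" "\<beta> permutes {..<r2}"
    "V1 = U1 * perm_mat r1 \<alpha>" "V2 = U2 * perm_mat r2 \<beta>"
    "\<And>a b. a < r1 \<Longrightarrow> b < r2 \<Longrightarrow> \<sigma> (a + b * r1) = \<alpha> a + \<beta> b * r1"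
proof -
  \<comment> \<open>\<open>f\<close> and \<open>g\<close> split the image of the column pair
    \<open>(a, b)\<close> into a pair again; a priori each depends on both arguments.\<close>
  define f where "f a b = \<sigma> (a + b * r1) mod r1" for a b
  define g where "g a b = \<sigma> (a + b * r1) div r1" for a b
  note W = kron_carrier[OF U(1,2)]
  have \<sigma>_less: "\<sigma> (a + b * r1) < r1 * r2" if "a < r1" "b < r2" for a b
    using permutes_in_image[OF \<sigma>, of "a + b * r1"] pair_index_less[OF that] by simp
  have f_less: "f a b < r1" and g_less: "g a b < r2" if "a < r1" "b < r2" for a b
    using \<sigma>_less[OF that] pos by (auto simp: f_def g_def less_mult_imp_div_less mult.commute)
  have \<sigma>_eq: "\<sigma> (a + b * r1) = f a b + g a b * r1" for a b
    by (simp add: f_def g_def)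
  have entry: "V1 $$ (i, a) * V2 $$ (j, b) = U1 $$ (i, f a b) * U2 $$ (j, g a b)"
    if "i < n1" "j < n2" "a < r1" "b < r2" for i j a b
  proof -
    have "V1 $$ (i, a) * V2 $$ (j, b) = (V1 \<otimes>\<^sub>k V2) $$ (i + j * n1, a + b * r1)"
      using index_kron[of i V1 j V2 a b] that V by simp
    also have "\<dots> = (U1 \<otimes>\<^sub>k U2) $$ (i + j * n1, \<sigma> (a + b * r1))"
      unfolding eq[symmetric] using that
      by (intro mult_perm_mat_index[OF W \<sigma>]) (auto simp: pair_index_less)
    also have "\<dots> = U1 $$ (i, f a b) * U2 $$ (j, g a b)"
      using index_kron[of i U1 j U2 "f a b" "g a b"] that U f_less g_less by (simp add: \<sigma>_eq)
    finally show ?thesis .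
  qed
  have V1_eq: "V1 $$ (i, a) = U1 $$ (i, f a b)" if "i < n1" "a < r1" "b < r2" for i a b
  proof -
    have "V1 $$ (i, a) = (\<Sum>j<n2. V1 $$ (i, a) * V2 $$ (j, b))"
      using V that by (simp add: transpose_ones_eq_iff flip: sum_distrib_left)
    also have "\<dots> = (\<Sum>j<n2. U1 $$ (i, f a b) * U2 $$ (j, g a b))"
      using that by (simp add: entry)
    also have "\<dots> = U1 $$ (i, f a b)"
      using U that g_less by (simp add: transpose_ones_eq_iff flip: sum_distrib_left)
    finally show ?thesis .
  qed
  have V2_eq: "V2 $$ (j, b) = U2 $$ (j, g a b)" if "j < n2" "a < r1" "b < r2" for j a b
  proof -
    have "V2 $$ (j, b) = (\<Sum>i<n1. V1 $$ (i, a) * V2 $$ (j, b))"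
      using V that by (simp add: transpose_ones_eq_iff flip: sum_distrib_right)
    also have "\<dots> = (\<Sum>i<n1. U1 $$ (i, f a b) * U2 $$ (j, g a b))"
      using that by (simp add: entry)
    also have "\<dots> = U2 $$ (j, g a b)"
      using U that f_less by (simp add: transpose_ones_eq_iff flip: sum_distrib_right)
    finally show ?thesis .
  qed
  \<comment> \<open>Equal columns in both factors give equal columns of the Kronecker product, so
    \<open>inj\<close> identifies the indices.\<close>
  have kron_inj: "c = c' \<and> d = d'"
    if "c < r1" "c' < r1" "d < r2" "d' < r2"
      and "\<And>i. i < n1 \<Longrightarrow> U1 $$ (i, c) = U1 $$ (i, c')" "\<And>j. j < n2 \<Longrightarrow> U2 $$ (j, d) = U2 $$ (j, d')"
    for c c' d d'
  proof -
    have "col (U1 \<otimes>\<^sub>k U2) (c + d * r1) = col (U1 \<otimes>\<^sub>k U2) (c' + d' * r1)"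
    proof (rule eq_vecI)
      fix p
      assume "p < dim_vec (col (U1 \<otimes>\<^sub>k U2) (c' + d' * r1))"
      then have "p < n1 * n2"
        using W by simp
      then obtain i j where ij: "i < n1" "j < n2" "p = i + j * n1"
        by (rule pair_indexE)
      then show "col (U1 \<otimes>\<^sub>k U2) (c + d * r1) $ p = col (U1 \<otimes>\<^sub>k U2) (c' + d' * r1) $ p"
        using index_kron[of i U1 j U2 c d] index_kron[of i U1 j U2 c' d'] that U W
        by (simp add: pair_index_less)
    qed simp
    then have "c + d * r1 = c' + d' * r1"
      using inj_onD[OF inj] that by (simp add: pair_index_less)
    then have "(c + d * r1) mod r1 = (c' + d' * r1) mod r1" "(c + d * r1) div r1 = (c' + d' * r1) div r1"
      by simp_all
    then show ?thesis
      using that by simp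
  qed
  \<comment> \<open>Columns \<open>f a b\<close> and \<open>f a 0\<close> of \<open>U1\<close> both
    equal column \<open>a\<close> of \<open>V1\<close>. For \<open>kron_inj\<close> the column of
    \<open>U2\<close> is frozen at index 0, available by \<open>pos\<close>.\<close>
  have f_const: "f a b = f a 0" if "a < r1" "b < r2" for a b
    using kron_inj[of "f a b" "f a 0" 0 0] V1_eq that f_less pos by (metis (no_types, lifting))
  have g_const: "g a b = g 0 b" if "a < r1" "b < r2" for a b
    using kron_inj[of 0 0 "g a b" "g 0 b"] V2_eq that g_less pos by (metis (no_types, lifting))
  have \<sigma>_split: "\<sigma> (a + b * r1) = f a 0 + g 0 b * r1" if "a < r1" "b < r2" for a b
    using \<sigma>_eq[of a b] f_const[OF that] g_const[OF that] by simp
  define \<alpha> where "\<alpha> a = (if a < r1 then f a 0 else a)" for a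
  define \<beta> where "\<beta> b = (if b < r2 then g 0 b else b)" for b
  have \<alpha>: "\<alpha> permutes {..<r1}"
    unfolding \<alpha>_def
  proof (rule permutes_extend)
    show "inj_on (\<lambda>a. f a 0) {..<r1}"
    proof (rule inj_onI)
      fix a a'
      assume a: "a \<in> {..<r1}" "a' \<in> {..<r1}" "f a 0 = f a' 0"
      then have "\<sigma> (a + 0 * r1) = \<sigma> (a' + 0 * r1)"
        using pos by (simp only: \<sigma>_split lessThan_iff)
      then show "a = a'"
        using permutes_inj[OF \<sigma>] by (simp add: inj_eq)
    qed
  qed (use f_less pos in auto)
  have \<beta>: "\<beta> permutes {..<r2}"
    unfolding \<beta>_def
  proof (rule permutes_extend)
    show "inj_on (\<lambda>b. g 0 b) {..<r2}"
    proof (rule inj_onI)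
      fix b b'
      assume b: "b \<in> {..<r2}" "b' \<in> {..<r2}" "g 0 b = g 0 b'"
      then have "\<sigma> (0 + b * r1) = \<sigma> (0 + b' * r1)"
        using pos by (simp only: \<sigma>_split lessThan_iff)
      then show "b = b'"
        using permutes_inj[OF \<sigma>] pos by (simp add: inj_eq)
    qed
  qed (use g_less pos in auto)
  show ?thesis
  proof
    show "V1 = U1 * perm_mat r1 \<alpha>"
      using U V pos by (intro eq_matI)
        (auto simp: mult_perm_mat_index[OF U(1) \<alpha>] V1_eq[of _ _ 0] \<alpha>_def
          simp del: index_mult_mat(1))
    show "V2 = U2 * perm_mat r2 \<beta>"
      using U V pos by (intro eq_matI)
        (auto simp: mult_perm_mat_index[OF U(2) \<beta>] V2_eq[of _ 0] \<beta>_def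
          simp del: index_mult_mat(1))
    show "\<sigma> (a + b * r1) = \<alpha> a + \<beta> b * r1" if "a < r1" "b < r2" for a b
      using \<sigma>_split that by (simp add: \<alpha>_def \<beta>_def)
  qed (fact \<alpha> \<beta>)+
qed

text \<open>Row \<open>a\<close> of the transposed permutation matrix has its only 1 at
  \<open>\<alpha> a\<close>, so each sum collapses to one term. The value 0 outside the range makes
  this an equality of functions.\<close>

lemma multilinear_mult_perm_mats:
  assumes perm: "\<alpha> permutes {..<r1}" "\<beta> permutes {..<r2}" "\<gamma> permutes {..<r3}"
  shows "multilinear_mult ((perm_mat r1 \<alpha>)\<^sup>T) ((perm_mat r2 \<beta>)\<^sup>T) ((perm_mat r3 \<gamma>)\<^sup>T) G
    = (\<lambda>a b k. if a < r1 \<and> b < r2 \<and> k < r3 then G (\<alpha> a) (\<beta> b) (\<gamma> k) else 0)"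
proof (intro ext)
  fix a b k
  have 1: "(\<Sum>i<n. (if i = \<pi> j then 1 else 0) * F i) = F (\<pi> j)"
    if "\<pi> permutes {..<n}" "j < n" for \<pi> j n and F :: "nat \<Rightarrow> real"
    using permutes_in_image[OF that(1), of j] that(2) by (simp add: if_distrib[of "\<lambda>x. x * _"] cong: if_cong)
  show "multilinear_mult ((perm_mat r1 \<alpha>)\<^sup>T) ((perm_mat r2 \<beta>)\<^sup>T) ((perm_mat r3 \<gamma>)\<^sup>T) G a b k
    = (if a < r1 \<and> b < r2 \<and> k < r3 then G (\<alpha> a) (\<beta> b) (\<gamma> k) else 0)"
  proof (cases "a < r1 \<and> b < r2 \<and> k < r3")
    case True
    then have "multilinear_mult ((perm_mat r1 \<alpha>)\<^sup>T) ((perm_mat r2 \<beta>)\<^sup>T) ((perm_mat r3 \<gamma>)\<^sup>T) G a b k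
      = (\<Sum>i1<r1. (if i1 = \<alpha> a then 1 else 0) * (\<Sum>i2<r2. (if i2 = \<beta> b then 1 else 0) *
          (\<Sum>i3<r3. (if i3 = \<gamma> k then 1 else 0) * G i1 i2 i3)))"
      by (simp add: multilinear_mult_def perm_mat_def mult.assoc flip: sum_distrib_left)
    also have "\<dots> = G (\<alpha> a) (\<beta> b) (\<gamma> k)"
      using True by (simp add: 1[OF perm(1)] 1[OF perm(2)] 1[OF perm(3)])
    finally show ?thesis
      using True by simp
  qed (auto simp: multilinear_mult_def)
qed

subsection \<open>Uniqueness of minimum-volume factorizations\<close>

text \<open>The left inverses yield the change-of-basis matrices \<open>A = L * X\<close> and
  \<open>B = M * Y\<close>, and multiplying by them on both sides yields
  \<open>G = A * H * B\<^sup>T\<close>. Since \<open>det G\<close> is nonzero, all three factors are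
  invertible and can be cancelled to recover \<open>X\<close> and \<open>Y\<close>.\<close>

lemma factors_of_same_product:
  fixes W X U Y :: "'a :: field mat"
  assumes W: "W \<in> carrier_mat m r" "L \<in> carrier_mat r m" "L * W = 1\<^sub>m r"
    and U: "U \<in> carrier_mat n r" "M \<in> carrier_mat r n" "M * U = 1\<^sub>m r"
    and X: "X \<in> carrier_mat m r" and Y: "Y \<in> carrier_mat n r"
    and G: "G \<in> carrier_mat r r" "det G \<noteq> 0" and H: "H \<in> carrier_mat r r"
    and eq: "W * G * U\<^sup>T = X * H * Y\<^sup>T"
  obtains A B where "A \<in> carrier_mat r r" "B \<in> carrier_mat r r"
    "X = W * A" "Y = U * B" "G = A * H * B\<^sup>T"
proof -
  define A where "A = L * X"
  define B where "B = M * Y"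
  have A: "A \<in> carrier_mat r r" and B: "B \<in> carrier_mat r r"
    using W U X Y by (auto simp: A_def B_def)
  have UM: "U\<^sup>T * M\<^sup>T = 1\<^sub>m r"
    using U by (metis transpose_mult transpose_one)
  have BT: "B\<^sup>T = Y\<^sup>T * M\<^sup>T"
    using U Y by (simp add: B_def transpose_mult[of _ r n])
  have eqM: "W * G = X * H * B\<^sup>T"
  proof -
    have "W * G = W * G * (U\<^sup>T * M\<^sup>T)"
      using W G by (simp add: UM)
    also have "\<dots> = W * G * U\<^sup>T * M\<^sup>T"
      using W G U by (intro assoc_mult_mat[symmetric]) auto
    also have "\<dots> = X * H * (Y\<^sup>T * M\<^sup>T)"
      unfolding eq using X H Y U by (intro assoc_mult_mat) auto
    finally show ?thesis
      by (simp add: BT)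
  qed
  have eqL: "G * U\<^sup>T = A * H * Y\<^sup>T"
  proof -
    have "G * U\<^sup>T = (L * W) * (G * U\<^sup>T)"
      using W G U by simp
    also have "\<dots> = L * (W * (G * U\<^sup>T))"
      using W G U by (intro assoc_mult_mat) auto
    also have "W * (G * U\<^sup>T) = X * (H * Y\<^sup>T)"
      using eq W G U X H Y by simp
    also have "L * (X * (H * Y\<^sup>T)) = A * (H * Y\<^sup>T)"
      unfolding A_def using W X H Y by (intro assoc_mult_mat[symmetric]) auto
    finally show ?thesis
      using A H Y by simp
  qed
  have GAB: "G = A * H * B\<^sup>T"
  proof -
    have "G = L * (W * G)"
      using W G by (simp flip: assoc_mult_mat)
    also have "\<dots> = L * (X * (H * B\<^sup>T))"
      using X H B by (simp add: eqM)
    also have "\<dots> = A * (H * B\<^sup>T)"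
      unfolding A_def using W X H B by (intro assoc_mult_mat[symmetric]) auto
    finally show ?thesis
      using A H B by simp
  qed
  have inv: "\<exists>D\<in>carrier_mat r r. C * D = 1\<^sub>m r \<and> D * C = 1\<^sub>m r"
    if "C \<in> carrier_mat r r" "det C \<noteq> 0" for C :: "'a mat"
    using det_non_zero_imp_unit[OF that] by (auto simp: Units_def ring_mat_def)
  have det: "det G = det A * det H * det B"
    using A B H by (simp add: GAB det_mult[of _ r] det_transpose[of _ r])
  \<comment> \<open>\<open>X\<close> and \<open>W * A\<close> both give \<open>W * G\<close> when
    multiplied by \<open>H * B\<^sup>T\<close>, which is invertible.\<close>
  have X_eq: "X = W * A"
  proof -
    have HB: "H * B\<^sup>T \<in> carrier_mat r r"
      using H B by auto
    have "det (H * B\<^sup>T) \<noteq> 0"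
      using det G(2) H B by (simp add: det_mult[of _ r] det_transpose[of _ r])
    then obtain D where D: "D \<in> carrier_mat r r" "H * B\<^sup>T * D = 1\<^sub>m r"
      using inv[OF HB] by blast
    have "X = X * (H * B\<^sup>T * D)"
      using X D by simp
    also have "\<dots> = X * (H * B\<^sup>T) * D"
      using X HB D by (intro assoc_mult_mat[symmetric]) auto
    also have "X * (H * B\<^sup>T) = W * G"
      using X H B eqM by simp
    also have "W * G = W * (A * (H * B\<^sup>T))"
      using A H B by (simp add: GAB)
    also have "\<dots> = W * A * (H * B\<^sup>T)"
      using W A HB by (intro assoc_mult_mat[symmetric]) auto
    also have "W * A * (H * B\<^sup>T) * D = W * A * (H * B\<^sup>T * D)"
      using W A HB D by (intro assoc_mult_mat) auto
    finally show ?thesis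
      using W A D by simp
  qed
  \<comment> \<open>The mirror image: \<open>A * H\<close> is cancelled on the left of two
    expressions for \<open>G * U\<^sup>T\<close>.\<close>
  have Y_eq: "Y = U * B"
  proof -
    have AH: "A * H \<in> carrier_mat r r"
      using A H by auto
    have "det (A * H) \<noteq> 0"
      using det G(2) A H by (simp add: det_mult[of _ r])
    then obtain D where D: "D \<in> carrier_mat r r" "D * (A * H) = 1\<^sub>m r"
      using inv[OF AH] by blast
    have "Y\<^sup>T = D * (A * H) * Y\<^sup>T"
      using Y D by simp
    also have "\<dots> = D * (A * H * Y\<^sup>T)"
      using Y AH D by (intro assoc_mult_mat) auto
    also have "A * H * Y\<^sup>T = A * H * (B\<^sup>T * U\<^sup>T)"
      unfolding eqL[symmetric] GAB using AH B U by (intro assoc_mult_mat) auto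
    also have "D * \<dots> = D * (A * H) * (B\<^sup>T * U\<^sup>T)"
      using D AH B U by (intro assoc_mult_mat[symmetric]) auto
    also have "\<dots> = (U * B)\<^sup>T"
      using D U B by (simp add: transpose_mult[of _ n r])
    finally show ?thesis
      by (metis transpose_transpose)
  qed
  show ?thesis
    using that A B X_eq Y_eq GAB by blast
qed

text \<open>Minimality of \<open>\<bar>det H\<bar>\<close> makes the two change-of-basis matrices extremal for Hadamard's
  inequality, and SSC then forces them to be permutations.\<close>

lemma SSC_min_volume_unique:
  assumes W: "W \<in> carrier_mat m r" "SSC W" "W\<^sup>T *\<^sub>v ones_vec m = ones_vec r"
    and U: "U \<in> carrier_mat n r" "SSC U" "U\<^sup>T *\<^sub>v ones_vec n = ones_vec r"
    and X: "X \<in> carrier_mat m r" "nonneg_mat X" "X\<^sup>T *\<^sub>v ones_vec m = ones_vec r"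
    and Y: "Y \<in> carrier_mat n r" "nonneg_mat Y" "Y\<^sup>T *\<^sub>v ones_vec n = ones_vec r"
    and G: "G \<in> carrier_mat r r" "det G \<noteq> 0" and H: "H \<in> carrier_mat r r"
    and eq: "W * G * U\<^sup>T = X * H * Y\<^sup>T" and min: "\<bar>det H\<bar> \<le> \<bar>det G\<bar>"
  obtains A B where "permutation_mat r A" "permutation_mat r B"
    "X = W * A" "Y = U * B" "G = A * H * B\<^sup>T"
proof -
  obtain L M where "L \<in> carrier_mat r m" "L * W = 1\<^sub>m r" "M \<in> carrier_mat r n" "M * U = 1\<^sub>m r"
    using SSC_left_inverse[OF W(1,2)] SSC_left_inverse[OF U(1,2)] by metis
  then obtain A B where A: "A \<in> carrier_mat r r" and B: "B \<in> carrier_mat r r"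
    and XY: "X = W * A" "Y = U * B" and GAB: "G = A * H * B\<^sup>T"
    using factors_of_same_product[OF W(1) _ _ U(1) _ _ X(1) Y(1) G H eq] by metis
  have A_le: "\<bar>det A\<bar> \<le> 1" and B_le: "\<bar>det B\<bar> \<le> 1"
    using SSC_det_le[OF W A] SSC_det_le[OF U B] X Y XY by auto
  have det: "\<bar>det G\<bar> = \<bar>det A\<bar> * \<bar>det B\<bar> * \<bar>det H\<bar>"
    using A B H by (simp add: GAB det_mult[of _ r] det_transpose[of _ r] abs_mult)
  then have "\<bar>det H\<bar> > 0"
    using G(2) by auto
  \<comment> \<open>Minimality divided by the positive \<open>\<bar>det H\<bar>\<close>; as both
    factors are at most 1, each must equal 1.\<close>
  then have "1 \<le> \<bar>det A\<bar> * \<bar>det B\<bar>"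
    using min unfolding det by simp
  moreover have "\<bar>det A\<bar> * \<bar>det B\<bar> \<le> \<bar>det A\<bar>" "\<bar>det A\<bar> * \<bar>det B\<bar> \<le> \<bar>det B\<bar>"
    using A_le B_le by (simp_all add: mult_left_le mult_left_le_one_le)
  ultimately have "\<bar>det A\<bar> = 1" "\<bar>det B\<bar> = 1"
    using A_le B_le by linarith+
  then have "permutation_mat r A" "permutation_mat r B"
    using SSC_det_eq[OF W A] SSC_det_eq[OF U B] X Y XY by auto
  then show ?thesis
    using that XY GAB by blast
qed

section \<open>Identifiability of the tensor factorization\<close>

lemma kron_ones:
  assumes "A \<in> carrier_mat m M" "B \<in> carrier_mat n N"
    and "A\<^sup>T *\<^sub>v ones_vec m = ones_vec M" "B\<^sup>T *\<^sub>v ones_vec n = ones_vec N"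
  shows "(A \<otimes>\<^sub>k B)\<^sup>T *\<^sub>v ones_vec (m * n) = ones_vec (M * N)"
  unfolding transpose_ones_eq_iff[OF kron_carrier[OF assms(1,2)]]
proof (intro allI impI)
  fix q
  assume "q < M * N"
  then obtain a b where q: "a < M" "b < N" "q = a + b * M"
    by (rule pair_indexE)
  have "(A \<otimes>\<^sub>k B) $$ (i + j * m, q) = A $$ (i, a) * B $$ (j, b)" if "i < m" "j < n" for i j
    using index_kron[of i A j B a b] assms(1,2) that q by simp
  then have "(\<Sum>p<m * n. (A \<otimes>\<^sub>k B) $$ (p, q)) = (\<Sum>i<m. \<Sum>j<n. A $$ (i, a) * B $$ (j, b))"
    by (simp add: sum_pair_index)
  also have "\<dots> = 1"
    using assms q by (simp add: transpose_ones_eq_iff flip: sum_distrib_left)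
  finally show "(\<Sum>p<m * n. (A \<otimes>\<^sub>k B) $$ (p, q)) = 1" .
qed

theorem theorem5p4:
  fixes n1 n2 n3 r1 r2 r3 :: nat
    and \<T> \<G> \<G>' :: tensor3
    and U1 U2 U3 U1' U2' U3' :: "real mat"
  assumes T_carrier: "\<T> \<in> carrier_tensor n1 n2 n3"
    and T_eq: "\<T> = multilinear_mult U1 U2 U3 \<G>"
    and U1: "U1 \<in> carrier_mat n1 r1" "nonneg_mat U1" "U1\<^sup>T *\<^sub>v ones_vec n1 = ones_vec r1"
    and U2: "U2 \<in> carrier_mat n2 r2" "nonneg_mat U2" "U2\<^sup>T *\<^sub>v ones_vec n2 = ones_vec r2"
    and U3: "U3 \<in> carrier_mat n3 r3" "nonneg_mat U3" "U3\<^sup>T *\<^sub>v ones_vec n3 = ones_vec r3"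
    and G_carrier: "\<G> \<in> carrier_tensor r1 r2 r3"
    and rank_G: "vec_space.rank (r1 * r2) (unfold3 r1 r2 r3 \<G>) = r3"
    and r3: "r3 = r1 * r2"
    and SSC12: "SSC (U1 \<otimes>\<^sub>k U2)"
    and SSC3: "SSC U3"
    and proc_output: "procedure_output n1 n2 n3 r1 r2 r3 \<T> U1' U2' U3' \<G>'"
  shows "\<exists>\<Pi>1 \<Pi>2 \<Pi>3.
           permutation_mat r1 \<Pi>1 \<and> permutation_mat r2 \<Pi>2 \<and> permutation_mat r3 \<Pi>3 \<and>
           U1' = U1 * \<Pi>1 \<and> U2' = U2 * \<Pi>2 \<and> U3' = U3 * \<Pi>3 \<and>
           \<G>' = multilinear_mult (\<Pi>1\<^sup>T) (\<Pi>2\<^sup>T) (\<Pi>3\<^sup>T) \<G>"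
proof -
  define r where "r = r1 * r2"
  have r3r: "r3 = r"
    using r3 by (simp add: r_def)
  define W where "W = U1 \<otimes>\<^sub>k U2"
  define G where "G = unfold3 r1 r2 r3 \<G>"
  have W: "W \<in> carrier_mat (n1 * n2) r" "SSC W" "nonneg_mat W"
    "W\<^sup>T *\<^sub>v ones_vec (n1 * n2) = ones_vec r"
    using SSC12 kron_carrier[OF U1(1) U2(1)] kron_ones[OF U1(1) U2(1) U1(3) U2(3)]
    by (simp_all add: W_def r_def SSC_def)
  have "2 \<le> r"
    using W by (auto simp: SSC_def)
  \<comment> \<open>Neither mode is empty, so index 0 exists in both, as
    \<open>kron_column_permutation\<close> requires.\<close>
  then have pos: "0 < r1" "0 < r2"
    by (auto simp: r_def intro: ccontr)
  have G: "G \<in> carrier_mat r r"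
    using unfold3_carrier[of r1 r2 r3 \<G>] by (simp add: G_def r3r r_def)
  \<comment> \<open>The unfolding is square because \<open>r3 = r1 * r2\<close>, so full rank means
    nonsingular.\<close>
  have det_G: "det G \<noteq> 0"
    using vec_space.det_rank_iff[OF G] rank_G by (simp add: G_def r3r r_def)
  have T: "unfold3 n1 n2 n3 \<T> = W * G * U3\<^sup>T"
    unfolding T_eq W_def G_def by (rule unfold3_multilinear_mult) fact+
  obtain H U12 P where opt: "min_vol_optimal n1 n2 n3 r1 r2 r3 \<T> H U12 U3'"
    and P: "permutation_mat r P"
    and U': "U1' \<in> carrier_mat n1 r1" "U2' \<in> carrier_mat n2 r2"
      "U1'\<^sup>T *\<^sub>v ones_vec n1 = ones_vec r1" "U2'\<^sup>T *\<^sub>v ones_vec n2 = ones_vec r2"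
    and U12P: "U12 * P = U1' \<otimes>\<^sub>k U2'"
    and G': "\<G>' \<in> carrier_tensor r1 r2 r3" "unfold3 r1 r2 r3 \<G>' = P\<^sup>T * H"
    using proc_output by (auto simp: procedure_output_def r_def)
  have feas: "min_vol_feasible n1 n2 n3 r1 r2 r3 \<T> (H, U12, U3')"
    using opt by (simp add: min_vol_optimal_def is_arg_min_def)
  then have H: "H \<in> carrier_mat r r"
    and U12: "U12 \<in> carrier_mat (n1 * n2) r" "nonneg_mat U12"
      "U12\<^sup>T *\<^sub>v ones_vec (n1 * n2) = ones_vec r"
    and U3': "U3' \<in> carrier_mat n3 r" "nonneg_mat U3'" "U3'\<^sup>T *\<^sub>v ones_vec n3 = ones_vec r"
    and eq: "W * G * U3\<^sup>T = U12 * H * U3'\<^sup>T"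
    by (simp_all add: min_vol_feasible_def r3r T flip: r_def)
  \<comment> \<open>The original factorization competes in the minimization, so it bounds the
    optimal volume.\<close>
  have "min_vol_feasible n1 n2 n3 r1 r2 r3 \<T> (G, W, U3)"
    using G W U3 by (simp add: min_vol_feasible_def r3r T flip: r_def)
  then have "\<bar>det H\<bar> \<le> \<bar>det G\<bar>"
    using opt by (force simp: min_vol_optimal_def is_arg_min_def)
  then obtain A B where A: "permutation_mat r A" and B: "permutation_mat r B"
    and U12_eq: "U12 = W * A" and U3'_eq: "U3' = U3 * B" and GAB: "G = A * H * B\<^sup>T"
    using SSC_min_volume_unique[OF W(1,2,4) _ SSC3 _ U12(1,2,3) U3' G det_G H eq] U3(1,3)
    unfolding r3r by metis
  obtain \<pi> \<rho> \<gamma> where perms: "\<pi> permutes {..<r}" "\<rho> permutes {..<r}" "\<gamma> permutes {..<r}"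
    and P_eq: "P = perm_mat r \<pi>" and A_eq: "A = perm_mat r \<rho>" and B_eq: "B = perm_mat r \<gamma>"
    using P A B by (auto simp: permutation_mat_iff)
  \<comment> \<open>\<open>A\<close> from uniqueness and \<open>P\<close> from the procedure merge
    into one column permutation of \<open>W\<close>, since
    \<open>U12 * P = W * (A * P)\<close>.\<close>
  define \<sigma> where "\<sigma> = \<rho> \<circ> \<pi>"
  have \<sigma>: "\<sigma> permutes {..<r}"
    unfolding \<sigma>_def by (rule permutes_compose) fact+
  have AP: "A * P = perm_mat r \<sigma>"
    unfolding A_eq P_eq \<sigma>_def by (rule perm_mat_mult) fact+
  have carr: "A \<in> carrier_mat r r" "B \<in> carrier_mat r r" "P \<in> carrier_mat r r"
    by (simp_all add: A_eq B_eq P_eq)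
  obtain L where L: "L \<in> carrier_mat r (n1 * n2)" "L * W = 1\<^sub>m r"
    using SSC_left_inverse[OF W(1,2)] .
  \<comment> \<open>The left inverse sends the columns of \<open>W\<close> to distinct unit
    vectors.\<close>
  have inj: "inj_on (col W) {..<r}"
  proof (rule inj_onI)
    fix i j
    assume ij: "i \<in> {..<r}" "j \<in> {..<r}" "col W i = col W j"
    then have "L *\<^sub>v col W i = L *\<^sub>v col W j"
      by simp
    then have "col (1\<^sub>m r) i = (col (1\<^sub>m r) j :: real vec)"
      using ij col_mult2[OF L(1) W(1)] by (simp add: L(2))
    then have "unit_vec r i $ i = (unit_vec r j $ i :: real)"
      using ij by simp
    then show "i = j"
      using ij by (simp split: if_splits)
  qed
  have "W * perm_mat r \<sigma> = U1' \<otimes>\<^sub>k U2'"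
    using U12P W carr by (simp add: U12_eq flip: AP)
  then obtain \<alpha> \<beta> where \<alpha>: "\<alpha> permutes {..<r1}" and \<beta>: "\<beta> permutes {..<r2}"
    and U1': "U1' = U1 * perm_mat r1 \<alpha>" and U2': "U2' = U2 * perm_mat r2 \<beta>"
    and \<sigma>_split: "\<And>a b. a < r1 \<Longrightarrow> b < r2 \<Longrightarrow> \<sigma> (a + b * r1) = \<alpha> a + \<beta> b * r1"
    using kron_column_permutation[OF U1(1) U2(1) U1(3) U2(3) U' _ pos] inj \<sigma>
    unfolding W_def r_def by metis
  \<comment> \<open>Transposes invert permutation matrices, so \<open>G = A * H * B\<^sup>T\<close>
    solves to \<open>H = A\<^sup>T * G * B\<close>, and multiplying by \<open>P\<^sup>T\<close>
    forms the transpose of \<open>A * P\<close>.\<close>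
  have "(perm_mat r \<sigma>)\<^sup>T * G * B = P\<^sup>T * H"
  proof -
    have AA: "A\<^sup>T * A = 1\<^sub>m r" and BB: "B\<^sup>T * B = 1\<^sub>m r"
      using perms by (simp_all add: A_eq B_eq transpose_perm_mat_mult_self)
    have "(perm_mat r \<sigma>)\<^sup>T = P\<^sup>T * A\<^sup>T"
      using carr by (simp add: transpose_mult[of _ r r] flip: AP)
    then have "(perm_mat r \<sigma>)\<^sup>T * G * B = P\<^sup>T * A\<^sup>T * (A * H * B\<^sup>T) * B"
      by (simp add: GAB)
    also have "\<dots> = P\<^sup>T * ((A\<^sup>T * A) * (H * (B\<^sup>T * B)))"
      using carr H by (simp add: assoc_mult_mat[of _ r r _ r _ r])
    also have "\<dots> = P\<^sup>T * H"
      using carr H by (simp add: AA BB)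
    finally show ?thesis .
  qed
  then have G'_eq: "unfold3 r1 r2 r3 \<G>' = (perm_mat r \<sigma>)\<^sup>T * G * perm_mat r \<gamma>"
    by (simp add: G' B_eq)
  \<comment> \<open>In the unfolding \<open>\<sigma>\<close> moves the row index and
    \<open>\<gamma>\<close> the column index; \<open>\<sigma>_split\<close> resolves the row move
    into one move per mode.\<close>
  have "\<G>' a b k = \<G> (\<alpha> a) (\<beta> b) (\<gamma> k)" if abk: "a < r1" "b < r2" "k < r3" for a b k
  proof -
    have q: "a + b * r1 < r"
      using abk by (simp add: r_def pair_index_less)
    have less: "\<alpha> a < r1" "\<beta> b < r2" "\<gamma> k < r3"
      using abk permutes_in_image[OF \<alpha>, of a] permutes_in_image[OF \<beta>, of b]
        permutes_in_image[OF perms(3), of k] by (simp_all add: r3r)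
    have "\<G>' a b k = ((perm_mat r \<sigma>)\<^sup>T * G * perm_mat r \<gamma>) $$ (a + b * r1, k)"
      using abk by (simp add: index_unfold3 flip: G'_eq)
    also have "\<dots> = ((perm_mat r \<sigma>)\<^sup>T * G) $$ (a + b * r1, \<gamma> k)"
      using abk q G by (intro mult_perm_mat_index[OF _ perms(3)]) (auto simp: r3r)
    also have "\<dots> = G $$ (\<sigma> (a + b * r1), \<gamma> k)"
      using q less by (intro transpose_perm_mat_mult_index[OF G \<sigma>]) (auto simp: r3r)
    also have "\<dots> = \<G> (\<alpha> a) (\<beta> b) (\<gamma> k)"
      using abk less by (simp add: \<sigma>_split G_def index_unfold3)
    finally show ?thesis .
  qed
  \<comment> \<open>Outside the index range both sides vanish, on the left by
    \<open>carrier_tensor\<close>.\<close>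
  then have "\<G>' = (\<lambda>a b k. if a < r1 \<and> b < r2 \<and> k < r3 then \<G> (\<alpha> a) (\<beta> b) (\<gamma> k) else 0)"
    using G'(1) by (auto simp: carrier_tensor_def fun_eq_iff)
  also have "\<dots> = multilinear_mult ((perm_mat r1 \<alpha>)\<^sup>T) ((perm_mat r2 \<beta>)\<^sup>T) ((perm_mat r3 \<gamma>)\<^sup>T) \<G>"
    using multilinear_mult_perm_mats[OF \<alpha> \<beta>] perms(3) by (simp add: r3r)
  finally have "\<G>' = multilinear_mult ((perm_mat r1 \<alpha>)\<^sup>T) ((perm_mat r2 \<beta>)\<^sup>T) ((perm_mat r3 \<gamma>)\<^sup>T) \<G>" .
  moreover have "permutation_mat r1 (perm_mat r1 \<alpha>)" "permutation_mat r2 (perm_mat r2 \<beta>)"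
      "permutation_mat r3 (perm_mat r3 \<gamma>)"
    using \<alpha> \<beta> perms(3) by (auto simp: permutation_mat_iff r3r)
  moreover have "U3' = U3 * perm_mat r3 \<gamma>"
    by (simp add: U3'_eq B_eq r3r)
  ultimately show ?thesis
    using U1' U2' by blast
qed

end
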